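(* Let $f_{0,0}=1$ and, for $n\ge1$ and $k\ge0$, let $f_{n,k}$ be the number of Dyck paths of semi-length $n$ with exactly $k$ marked down-steps, none of which is at ground level (and $f_{0,k}=0$ for $k\ge1$). Then the formal power series $F=F(t,x)=\sum_{n,k\ge0}f_{n,k}t^kx^n$ satisfies $$F=1+xF^2\cdot\frac{1}{1-t(F-1)}.$$
   Context: A Dyck path of semi-length $n$ is a lattice path from $(0,0)$ to $(2n,0)$ with steps $(1,1)$ (up) and $(1,-1)$ (down) never going below the $x$-axis. A down-step is at ground level if it ends on the $x$-axis. A Dyck path with $k$ marked down-steps means a Dyck path together with a $k$-element set of its down-steps. *)

theory Defs
  imports
    "HOL-Library.Product_Plus"
    "HOL-Computational_Algebra.Formal_Power_Series"
begin

datatype step = Up | Down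

fun step_vec :: "step \<Rightarrow> int \<times> int" where
  "step_vec Up = (1, 1)"
| "step_vec Down = (1, -1)"

definition position :: "step list \<Rightarrow> nat \<Rightarrow> int \<times> int" where
  "position p i = sum_list (map step_vec (take i p))"

definition dyck_path :: "nat \<Rightarrow> step list \<Rightarrow> bool" where
  "dyck_path n p \<longleftrightarrow>
     position p (length p) = (2 * int n, 0) \<and>
     (\<forall>i\<le>length p. 0 \<le> snd (position p i))"

text \<open>A step of a path is identified by its index; step \<open>i\<close> leads from
  \<open>position p i\<close> to \<open>position p (Suc i)\<close>.\<close>

definition down_steps :: "step list \<Rightarrow> nat set" where
  "down_steps p = {i. i < length p \<and> p ! i = Down}"

definition at_ground_level :: "step list \<Rightarrow> nat \<Rightarrow> bool" where
  "at_ground_level p i \<longleftrightarrow> snd (position p (Suc i)) = 0"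

definition marked_dyck_paths :: "nat \<Rightarrow> nat \<Rightarrow> (step list \<times> nat set) set" where
  "marked_dyck_paths n k =
     {(p, M). dyck_path n p \<and> M \<subseteq> down_steps p \<and> card M = k \<and>
              (\<forall>i\<in>M. \<not> at_ground_level p i)}"

definition f_num :: "nat \<Rightarrow> nat \<Rightarrow> nat" where
  "f_num n k =
     (if n = 0 then (if k = 0 then 1 else 0) else card (marked_dyck_paths n k))"

text \<open>Bivariate series are series in \<open>x\<close> whose coefficients are series in \<open>t\<close>.
  Rational coefficients are used because the reciprocal of a series needs a coefficient type
  of class \<open>inverse\<close>, which \<^typ>\<open>int\<close> is not.\<close>

definition var_x :: "rat fps fps" where
  "var_x = fps_X"

definition var_t :: "rat fps fps" where
  "var_t = fps_const fps_X"

definition F_series :: "rat fps fps" where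
  "F_series = Abs_fps (\<lambda>n. Abs_fps (\<lambda>k. of_nat (f_num n k)))"

text \<open>The sets being counted are finite, so \<^const>\<open>card\<close> is their actual cardinality.\<close>

lemma fst_position: "i \<le> length p \<Longrightarrow> fst (position p i) = int i"
proof (induction i)
  case 0
  then show ?case by (simp add: position_def)
next
  case (Suc i)
  have "fst (step_vec s) = 1" for s by (cases s) auto
  with Suc show ?case by (simp add: position_def take_Suc_conv_app_nth)
qed

lemma dyck_path_length: "dyck_path n p \<Longrightarrow> length p = 2 * n"
  using fst_position[of "length p" p] by (simp add: dyck_path_def)

lemma finite_marked_dyck_paths: "finite (marked_dyck_paths n k)"
proof (rule finite_subset)
  show "marked_dyck_paths n k \<subseteq>
      {p. set p \<subseteq> {Up, Down} \<and> length p = 2 * n} \<times> Pow {..<2 * n}"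
  proof -
    have "set p \<subseteq> {Up, Down}" for p
      by (metis insert_iff step.exhaust subsetI)
    then show ?thesis
      by (auto simp: marked_dyck_paths_def down_steps_def subset_iff dest!: dyck_path_length)
  qed
  show "finite ({p. set p \<subseteq> {Up, Down} \<and> length p = 2 * n} \<times> Pow {..<2 * n})"
    by (intro finite_cartesian_product finite_lists_length_eq) auto
qed

text \<open>The coefficients \<^typ>\<open>rat fps\<close> do not form a field, but the denominator has constant term
  \<open>1\<close> in \<open>x\<close>, so the quotient below is the genuine reciprocal.\<close>

lemma denominator_reciprocal:
  "(1 - var_t * (F_series - 1)) * (1 / (1 - var_t * (F_series - 1))) = 1"
proof -
  let ?g = "1 - var_t * (F_series - 1)"
  have "fps_nth F_series 0 = 1"
    by (rule fps_ext) (simp add: F_series_def f_num_def)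
  then have g0: "fps_nth ?g 0 = 1" by (simp add: var_t_def)
  then have "1 / ?g = inverse ?g" by (subst fps_divide_unit) auto
  also have "\<dots> = fps_right_inverse ?g (inverse (fps_nth ?g 0))"
    by (rule fps_inverse_def)
  also have "\<dots> = fps_right_inverse ?g 1"
    unfolding g0 by simp
  finally show ?thesis
    using fps_right_inverse[of ?g 1] g0 by (metis mult_1_right)
qed

end

theory Submission
  imports Defs
begin

text \<open>Let \<open>G\<close> count Dyck paths with arbitrary marked down-steps. Every nonempty Dyck path is
  \<open>U p D q\<close> for unique Dyck paths \<open>p\<close> and \<open>q\<close>, where \<open>D\<close> is its first return to the axis. No
  down-step of \<open>p\<close> is at ground level in \<open>U p D q\<close>, so \<open>F = 1 + x G F\<close>, and likewise
  \<open>G = 1 + (1 + t) x G\<^sup>2\<close>. Multiplying the second equation by \<open>F = 1 / (1 - x G)\<close> gives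
  \<open>G (1 - t (F - 1)) = F\<close>, and eliminating \<open>G\<close> from the first one yields the claim.\<close>

section \<open>Heights of step lists and Dyck paths\<close>

definition height :: "step list \<Rightarrow> int" where
  "height p = sum_list (map (snd \<circ> step_vec) p)"

lemma height_simps [simp]:
  "height [] = 0"
  "height (Up # p) = height p + 1"
  "height (Down # p) = height p - 1"
  "height (p @ q) = height p + height q"
  by (simp_all add: height_def)

lemma snd_position: "snd (position p i) = height (take i p)"
proof -
  have "snd (sum_list (map step_vec l)) = height l" for l
    by (induction l) (auto simp: height_def)
  then show ?thesis by (simp add: position_def)
qed

text \<open>The index is unbounded because \<open>take\<close> past the end returns the whole list;
  this keeps length bounds out of later arguments.\<close>

definition nonneg_path :: "step list \<Rightarrow> bool" where
  "nonneg_path p \<longleftrightarrow> (\<forall>i. 0 \<le> height (take i p))"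

lemma dyck_path_iff:
  "dyck_path n p \<longleftrightarrow> length p = 2 * n \<and> height p = 0 \<and> nonneg_path p"
proof -
  have "nonneg_path p \<longleftrightarrow> (\<forall>i\<le>length p. 0 \<le> height (take i p))"
    unfolding nonneg_path_def by (metis nle_le take_all order_refl)
  then show ?thesis
    using fst_position[of "length p" p] snd_position[of p "length p"]
    by (auto simp: dyck_path_def snd_position prod_eq_iff)
qed

lemma height_eq_count:
  "height p = int (count_list p Up) - int (count_list p Down)"
  "length p = count_list p Up + count_list p Down"
proof (induction p)
  case (Cons s p)
  { case 1 show ?case using Cons by (cases s) auto }
  { case 2 show ?case using Cons by (cases s) auto }
qed simp_all

lemma dyck_path_count_Down: "dyck_path n p \<Longrightarrow> count_list p Down = n"
  using height_eq_count[of p] by (simp add: dyck_path_iff)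

section \<open>The first-return decomposition\<close>

abbreviation first_return_join :: "step list \<Rightarrow> step list \<Rightarrow> step list" where
  "first_return_join p q \<equiv> Up # p @ Down # q"

lemma dyck_path_first_return_join:
  assumes "dyck_path i p" "dyck_path j q"
  shows "dyck_path (Suc (i + j)) (first_return_join p q)"
proof -
  have "0 \<le> height (take m (first_return_join p q))" for m
  proof (cases m)
    case (Suc k)
    show ?thesis
    proof (cases "k \<le> length p")
      case True
      then show ?thesis using assms Suc by (auto simp: dyck_path_iff nonneg_path_def add_increasing2)
    next
      case False
      \<comment> \<open>This prefix is \<open>Up\<close>, \<open>p\<close>, \<open>Down\<close> and
        the first \<open>l\<close> steps of \<open>q\<close>; the part before \<open>q\<close> has
        height 0.\<close>
      then obtain l where "k = Suc (length p + l)"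
        by (metis add_Suc_right less_imp_Suc_add not_le)
      then show ?thesis using assms Suc by (auto simp: dyck_path_iff nonneg_path_def)
    qed
  qed simp
  then show ?thesis using assms by (simp add: dyck_path_iff nonneg_path_def)
qed

text \<open>If \<open>p'\<close> were longer, it would begin with \<open>p @ [Down]\<close>, a
  prefix of height -1. Used in both directions, this makes the decomposition unique.\<close>

lemma first_return_join_not_longer:
  assumes "height p = 0" "nonneg_path p'" "first_return_join p q = first_return_join p' q'"
  shows "length p' \<le> length p"
proof (rule ccontr)
  assume *: "\<not> length p' \<le> length p"
  have "take (Suc (length p)) (p @ Down # q) = take (Suc (length p)) (p' @ Down # q')"
    using assms(3) by simp
  then have "take (Suc (length p)) p' = p @ [Down]"
    using * by simp
  then have "height (take (Suc (length p)) p') = -1"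
    using assms(1) by simp
  then show False using assms(2) by (metis nonneg_path_def neg_0_le_iff_le not_one_le_zero)
qed

lemma first_return_join_inject:
  assumes "dyck_path i p" "dyck_path i' p'" "first_return_join p q = first_return_join p' q'"
  shows "p = p' \<and> q = q'"
proof -
  have "length p = length p'"
    using first_return_join_not_longer[of p p' q q'] first_return_join_not_longer[of p' p q' q] assms
    by (simp add: dyck_path_iff)
  then show ?thesis using assms(3) by simp
qed

lemma dyck_path_Suc_decompose:
  assumes "dyck_path (Suc n) r"
  obtains i p q where "i \<le> n" "dyck_path i p" "dyck_path (n - i) q" "r = first_return_join p q"
proof -
  have r: "length r = 2 * Suc n" "height r = 0" and nn: "\<And>m. 0 \<le> height (take m r)"
    using assms by (auto simp: dyck_path_iff nonneg_path_def)
  obtain s where s: "r = Up # s"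
  proof (cases r)
    case (Cons a s)
    then show ?thesis using nn[of 1] that by (cases a) auto
  qed (use r in simp)
  have ls: "length s = Suc (2 * n)" and hs: "height s = -1" using r s by auto
  \<comment> \<open>Dropping the initial \<open>Up\<close> lowers heights by 1, so the first return
    of \<open>r\<close> to the axis is the first negative height in \<open>s\<close>. It exists
    because \<open>s\<close> ends at -1.\<close>
  define m where "m = (LEAST m. height (take m s) < 0)"
  have ex: "height (take (length s) s) < 0" using hs by simp
  have m_neg: "height (take m s) < 0" and m_le: "m \<le> length s"
    using LeastI[of "\<lambda>m. height (take m s) < 0", OF ex]
      Least_le[of "\<lambda>m. height (take m s) < 0", OF ex]
    by (simp_all add: m_def)
  have before: "0 \<le> height (take l s)" if "l < m" for l
    using not_less_Least that unfolding m_def by force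
  obtain k where k: "m = Suc k" using m_neg by (cases m) auto
  define p where "p = take k s"
  define q where "q = drop m s"
  have kl: "k < length s" using m_le k by simp
  have tk: "take m s = p @ [s ! k]"
    using kl k by (simp add: p_def take_Suc_conv_app_nth)
  have p0: "0 \<le> height p" using before[of k] k by (simp add: p_def)
  \<comment> \<open>By minimality of \<open>m\<close> the height is nonnegative before this step and
    negative after it; so the step is \<open>Down\<close> and starts at height 0.\<close>
  have sk: "s ! k = Down" using m_neg p0 tk by (cases "s ! k") auto
  have hp: "height p = 0" using m_neg p0 tk sk by simp
  have s_eq: "s = p @ Down # q"
    using append_take_drop_id[of m s] tk sk by (simp add: q_def)
  have hq: "height q = 0" using hs hp s_eq by simp
  have np: "nonneg_path p"
    unfolding nonneg_path_def p_def using before k by (auto simp: min_def)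
  have nq: "nonneg_path q"
    unfolding nonneg_path_def
  proof
    fix l
    show "0 \<le> height (take l q)"
      using nn[of "Suc (Suc (length p + l))"] s s_eq hp by simp
  qed
  define i where "i = count_list p Up"
  have lp: "length p = 2 * i"
    using height_eq_count[of p] hp by (simp add: i_def)
  have lq: "length q = 2 * (n - i)" "i \<le> n"
    using ls s_eq lp by auto
  show ?thesis
    using that[of i p q] lp lq hp hq np nq s s_eq by (simp add: dyck_path_iff)
qed

lemma finite_dyck_paths: "finite {p. dyck_path n p}"
proof (rule finite_subset)
  show "{p. dyck_path n p} \<subseteq> {p. set p \<subseteq> {Up, Down} \<and> length p = 2 * n}"
    using step.exhaust by (auto simp: dyck_path_iff)
qed (intro finite_lists_length_eq, simp)

text \<open>The decomposition is a bijection. The weight \<open>w\<close> is left arbitrary so that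
  both the count of paths and the sum over markings can be split this way.\<close>

lemma sum_dyck_paths_Suc:
  fixes w :: "step list \<Rightarrow> 'a::comm_monoid_add"
  shows "(\<Sum>r | dyck_path (Suc n) r. w r) =
    (\<Sum>i\<le>n. \<Sum>p | dyck_path i p. \<Sum>q | dyck_path (n - i) q. w (first_return_join p q))"
proof -
  let ?S = "SIGMA i:{..n}. SIGMA p:{p. dyck_path i p}. {q. dyck_path (n - i) q}"
  have "bij_betw (\<lambda>(i, p, q). first_return_join p q) ?S {r. dyck_path (Suc n) r}"
    unfolding bij_betw_def
  proof (intro conjI set_eqI iffI)
    show "inj_on (\<lambda>(i, p, q). first_return_join p q) ?S"
    proof (rule inj_onI, elim SigmaE, simp only: prod.case mem_Collect_eq)
      fix i p q i' p' q'
      assume *: "dyck_path i p" "dyck_path i' p'"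
        and "first_return_join p q = first_return_join p' q'"
      then have "p = p'" "q = q'" using first_return_join_inject by blast+
      with * show "(i, p, q) = (i', p', q')" by (auto simp: dyck_path_iff)
    qed
  next
    fix r assume "r \<in> (\<lambda>(i, p, q). first_return_join p q) ` ?S"
    then obtain i p q where "i \<le> n" "dyck_path i p" "dyck_path (n - i) q"
      "r = first_return_join p q"
      by (elim imageE SigmaE) simp
    then show "r \<in> {r. dyck_path (Suc n) r}"
      using dyck_path_first_return_join[of i p "n - i" q] by simp
  next
    fix r assume "r \<in> {r. dyck_path (Suc n) r}"
    then have "dyck_path (Suc n) r" by simp
    then obtain i p q where *: "i \<le> n" "dyck_path i p" "dyck_path (n - i) q"
      "r = first_return_join p q"
      by (rule dyck_path_Suc_decompose)
    show "r \<in> (\<lambda>(i, p, q). first_return_join p q) ` ?S"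
      by (rule image_eqI[where x = "(i, p, q)"]) (use * in simp_all)
  qed
  from sum.reindex_bij_betw[OF this, of w]
  have "(\<Sum>r | dyck_path (Suc n) r. w r) = (\<Sum>(i, p, q)\<in>?S. w (first_return_join p q))"
    by (simp add: case_prod_unfold)
  also have "\<dots> = (\<Sum>i\<le>n. \<Sum>p | dyck_path i p. \<Sum>q | dyck_path (n - i) q. w (first_return_join p q))"
    by (simp add: sum.Sigma finite_dyck_paths)
  finally show ?thesis .
qed

section \<open>Down-steps above ground level\<close>

definition high_down_steps :: "step list \<Rightarrow> nat set" where
  "high_down_steps p = {i \<in> down_steps p. \<not> at_ground_level p i}"

text \<open>The first argument is the height at which the path starts.\<close>

fun num_high :: "int \<Rightarrow> step list \<Rightarrow> nat" where
  "num_high h [] = 0"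
| "num_high h (Up # p) = num_high (h + 1) p"
| "num_high h (Down # p) = (if h = 1 then 0 else 1) + num_high (h - 1) p"

text \<open>Splitting off index 0 matches the removal of the first step in the recursion of
  \<open>num_high\<close>.\<close>

lemma card_less_Suc_shift:
  "card {i. i < Suc n \<and> P i} = (if P 0 then 1 else 0) + card {i. i < n \<and> P (Suc i)}"
proof -
  have "{i. i < Suc n \<and> P i} = (if P 0 then {0} else {}) \<union> Suc ` {i. i < n \<and> P (Suc i)}"
    by (auto simp: image_iff less_Suc_eq_0_disj)
  then show ?thesis
    by (auto simp: card_image card_insert_if)
qed

lemma num_high_eq_card:
  "num_high h p = card {i. i < length p \<and> p ! i = Down \<and> h + height (take (Suc i) p) \<noteq> 0}"
proof (induction h p rule: num_high.induct)
  case (2 h p)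
  then show ?case
    by (simp add: card_less_Suc_shift algebra_simps)
next
  case (3 h p)
  then show ?case
    by (auto simp: card_less_Suc_shift algebra_simps)
qed simp

lemma card_high_down_steps: "card (high_down_steps p) = num_high 0 p"
  by (simp add: high_down_steps_def num_high_eq_card down_steps_def at_ground_level_def
      snd_position conj_assoc)

lemma num_high_append: "num_high h (p @ q) = num_high h p + num_high (h + height p) q"
  by (induction h p rule: num_high.induct) (auto simp: algebra_simps)

lemma num_high_above_ground:
  "(\<And>i. 0 < h + height (take i p)) \<Longrightarrow> num_high h p = count_list p Down"
proof (induction h p rule: num_high.induct)
  case (2 h p)
  have "0 < h + 1 + height (take i p)" for i using 2(2)[of "Suc i"] by simp
  then show ?case using 2(1) by simp
next
  case (3 h p)
  have "0 < h - 1 + height (take i p)" for i using 3(2)[of "Suc i"] by simp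
  \<comment> \<open>The prefix of length 1 gives \<open>h - 1 > 0\<close>, so this
    \<open>Down\<close> is counted.\<close>
  then show ?case using 3(1) 3(2)[of 1] by simp
qed simp

text \<open>Raised by 1, \<open>p\<close> stays above the axis, so all its \<open>i\<close>
  down-steps count. The \<open>Down\<close> after it lands on the axis and does not count;
  \<open>q\<close> starts at height 0.\<close>

lemma num_high_first_return_join:
  assumes "dyck_path i p"
  shows "num_high 0 (first_return_join p q) = i + num_high 0 q"
proof -
  have "num_high 1 p = count_list p Down"
  proof (rule num_high_above_ground)
    fix j show "0 < 1 + height (take j p)"
      using assms by (simp add: dyck_path_iff nonneg_path_def add_pos_nonneg)
  qed
  then show ?thesis
    using assms by (simp add: num_high_append dyck_path_count_Down dyck_path_iff)
qed

section \<open>From markings to generating functions\<close>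

lemma dyck_paths_0: "Collect (dyck_path 0) = {[]}"
  by (auto simp: dyck_path_iff nonneg_path_def)

lemma card_marked_dyck_paths:
  "card (marked_dyck_paths n k) = (\<Sum>p | dyck_path n p. num_high 0 p choose k)"
proof -
  have fin: "finite (high_down_steps p)" for p
    by (simp add: high_down_steps_def down_steps_def)
  have "marked_dyck_paths n k =
      (SIGMA p:{p. dyck_path n p}. {M. M \<subseteq> high_down_steps p \<and> card M = k})"
    by (auto simp: marked_dyck_paths_def high_down_steps_def)
  then show ?thesis
    using fin by (simp add: card_SigmaI finite_dyck_paths n_subsets card_high_down_steps)
qed

text \<open>The separate convention for \<open>n = 0\<close> agrees with the sum, whose only path is
  then \<open>[]\<close>, with no down-step to mark.\<close>

lemma f_num_eq_sum: "f_num n k = (\<Sum>p | dyck_path n p. num_high 0 p choose k)"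
  by (cases k) (simp_all add: f_num_def card_marked_dyck_paths dyck_paths_0)

lemma fps_nth_one_plus_X_power:
  "fps_nth ((1 + fps_X :: 'a::comm_ring_1 fps) ^ m) k = of_nat (m choose k)"
proof (induction m arbitrary: k)
  case 0
  then show ?case by (cases k) auto
next
  case (Suc m)
  then show ?case by (cases k) (simp_all add: algebra_simps)
qed

text \<open>Each down-step above ground is unmarked or marked, giving a factor \<open>1 + t\<close>;
  here \<open>fps_X\<close> is \<open>t\<close>.\<close>

lemma F_series_nth:
  "fps_nth F_series n = (\<Sum>p | dyck_path n p. (1 + fps_X) ^ num_high 0 p)"
  by (rule fps_ext) (simp add: F_series_def f_num_eq_sum fps_sum_nth fps_nth_one_plus_X_power)

text \<open>All \<open>n\<close> down-steps of a path may be marked, whence the factor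
  \<open>(1 + t)^n\<close>.\<close>

definition G_series :: "rat fps fps" where
  "G_series = Abs_fps (\<lambda>n. of_nat (card {p. dyck_path n p}) * (1 + fps_X) ^ n)"

section \<open>Functional equations and elimination of \<open>G\<close>\<close>

lemma card_dyck_paths_Suc:
  "card {p. dyck_path (Suc n) p} = (\<Sum>i\<le>n. card {p. dyck_path i p} * card {p. dyck_path (n - i) p})"
  using sum_dyck_paths_Suc[of "\<lambda>_. 1::nat" n] by simp

lemma G_series_eq: "G_series = 1 + (1 + var_t) * var_x * G_series ^ 2"
proof (rule fps_ext)
  fix n
  have vt: "(1 + var_t) * var_x * G_series ^ 2 = fps_const (1 + fps_X) * (fps_X * (G_series * G_series))"
    by (simp add: var_t_def var_x_def power2_eq_square algebra_simps flip: fps_const_add)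
  show "fps_nth G_series n = fps_nth (1 + (1 + var_t) * var_x * G_series ^ 2) n"
  proof (cases n)
    case 0
    then show ?thesis unfolding vt by (simp add: G_series_def dyck_paths_0)
  next
    case (Suc m)
    let ?c = "\<lambda>n. of_nat (card {p. dyck_path n p}) :: rat fps"
    have "fps_nth G_series (Suc m) = (\<Sum>i\<le>m. ?c i * ?c (m - i) * (1 + fps_X) ^ Suc m)"
      by (simp add: G_series_def card_dyck_paths_Suc sum_distrib_right del: power_Suc)
    also have "\<dots> = (\<Sum>i\<le>m. (1 + fps_X) * ((?c i * (1 + fps_X) ^ i) * (?c (m - i) * (1 + fps_X) ^ (m - i))))"
    proof (rule sum.cong)
      fix i assume "i \<in> {..m}"
      \<comment> \<open>The single factor \<open>1 + t\<close> belongs to the first-return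
        \<open>Down\<close>; the others are shared between the two subpaths, using
        \<open>i \<le> m\<close>.\<close>
      then have "(1 + fps_X :: rat fps) ^ Suc m =
          (1 + fps_X) * ((1 + fps_X) ^ i * (1 + fps_X) ^ (m - i))"
        by (simp flip: power_add)
      then show "?c i * ?c (m - i) * (1 + fps_X) ^ Suc m =
          (1 + fps_X) * ((?c i * (1 + fps_X) ^ i) * (?c (m - i) * (1 + fps_X) ^ (m - i)))"
        by (simp only: mult_ac)
    qed simp
    also have "\<dots> = (1 + fps_X) * fps_nth (G_series * G_series) m"
      by (simp only: G_series_def fps_mult_nth atLeast0AtMost sum_distrib_left fps_nth_Abs_fps)
    finally show ?thesis unfolding vt Suc by simp
  qed
qed

text \<open>In the exponent \<open>i + num_high 0 q\<close>, the part \<open>i\<close> yields a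
  coefficient of \<open>G_series\<close> and the rest one of \<open>F_series\<close>. The
  first-return \<open>Down\<close> is at ground level and gives no factor.\<close>

lemma F_series_eq: "F_series = 1 + var_x * G_series * F_series"
proof (rule fps_ext)
  fix n
  show "fps_nth F_series n = fps_nth (1 + var_x * G_series * F_series) n"
  proof (cases n)
    case 0
    then show ?thesis by (simp add: F_series_nth dyck_paths_0 var_x_def)
  next
    case (Suc m)
    have "fps_nth F_series (Suc m) =
        (\<Sum>i\<le>m. \<Sum>p | dyck_path i p. \<Sum>q | dyck_path (m - i) q. (1 + fps_X) ^ (i + num_high 0 q))"
      unfolding F_series_nth sum_dyck_paths_Suc
      by (intro sum.cong refl) (metis mem_Collect_eq num_high_first_return_join)
    also have "\<dots> = fps_nth (G_series * F_series) m"
      by (simp add: G_series_def F_series_nth fps_mult_nth atLeast0AtMost power_add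
          mult.assoc flip: sum_distrib_left)
    finally show ?thesis unfolding Suc
      by (simp add: var_x_def mult.assoc)
  qed
qed

lemma G_series_times_denominator: "G_series * (1 - var_t * (F_series - 1)) = F_series"
proof -
  let ?F = F_series and ?G = G_series and ?x = var_x and ?t = var_t
  have F: "?F * (1 - ?x * ?G) = 1"
    using F_series_eq by (simp add: algebra_simps)
  then have F1: "(?F - 1) * (1 - ?x * ?G) = ?x * ?G"
    by (simp add: algebra_simps)
  \<comment> \<open>Inserting \<open>?F * (1 - ?x * ?G) = 1\<close> lets \<open>F1\<close> replace
    \<open>?F - 1\<close> by a term in \<open>?G\<close>; what remains beside \<open>?F\<close> is
    the equation for \<open>?G\<close>.\<close>
  have "?G * (1 - ?t * (?F - 1)) = ?G * (1 - ?t * (?F - 1)) * (?F * (1 - ?x * ?G))"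
    by (simp only: F mult_1_right)
  also have "\<dots> = ?F * (?G * (1 - ?x * ?G) - ?t * ?G * ((?F - 1) * (1 - ?x * ?G)))"
    by (simp add: algebra_simps)
  also have "\<dots> = ?F * (?G - (1 + ?t) * ?x * ?G ^ 2)"
    unfolding F1 by (simp add: algebra_simps power2_eq_square)
  also have "?G - (1 + ?t) * ?x * ?G ^ 2 = 1"
    using G_series_eq by (metis add_diff_cancel_right')
  finally show ?thesis by simp
qed

theorem theorem7:
  shows "F_series = 1 + var_x * F_series ^ 2 * (1 / (1 - var_t * (F_series - 1)))"
proof -
  define A where "A = 1 / (1 - var_t * (F_series - 1))"
  have "(1 - var_t * (F_series - 1)) * A = 1"
    unfolding A_def by (rule denominator_reciprocal)
  \<comment> \<open>Multiplying \<open>G_series_times_denominator\<close> by \<open>A\<close>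
    cancels the denominator, so one factor \<open>F_series\<close> together with \<open>A\<close>
    becomes \<open>G_series\<close>.\<close>
  then have "F_series * A = G_series"
    by (metis G_series_times_denominator mult.assoc mult_1_right)
  then have "var_x * F_series ^ 2 * A = var_x * G_series * F_series"
    by (simp add: power2_eq_square mult_ac)
  then have "F_series = 1 + var_x * F_series ^ 2 * A"
    by (metis F_series_eq)
  then show ?thesis by (simp add: A_def)
qed

end
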